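(* Let $n\ge 1$, $\sigma_1,\dots,\sigma_n>0$, $\mu\in\mathbb{R}$, $\tau>0$, and set $S=\left(\sum_{j=1}^n \frac{1}{\sigma_j^2}\right)^{-1}$. Suppose $\Delta\sim N(\mu,\tau^2)$ (the prior $\pi$) and that $Y=\sum_{j=1}^n X_j/\sigma_j^2$ satisfies $Y\mid\Delta\sim N\!\left(\frac{\Delta}{S},\frac1S\right)$. For $\beta\in\mathbb{R}$ let $\delta_\beta(x)=\mathbf{1}\{y>\beta\}$, where $x=(x_1,\dots,x_n)$ and $y=\sum_{j=1}^n x_j/\sigma_j^2$, with Bayes risk $$r(\pi,\delta_\beta)=\mathbb{E}\left[-\Delta\,\mathbf{1}\{Y>\beta\}\right]=\mathbb{E}_{\Delta\sim\pi}\left[-\Delta\,\Phi\!\left(\frac{\Delta/S-\beta}{1/\sqrt S}\right)\right],$$ where $\Phi$ is the standard normal cumulative distribution function. Then $$\beta=\frac{-\mu}{\tau^2}$$ minimizes the Bayes risk $r(\pi,\delta_\beta)$ over $\beta\in\mathbb{R}$.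
   Context: Setting: a real unknown $\Delta$ (the true lift of a feature) has prior distribution $\pi$. One observes $n$ noisy measurements $X_1,\dots,X_n$ of $\Delta$, conditionally independent given $\Delta$, where $X_j$ has mean $\Delta$ and known variance $\sigma_j^2$; $Y$ is their inverse-variance weighted sum. (If $X_j\mid\Delta\sim N(\Delta,\sigma_j^2)$, then $Y\mid\Delta\sim N(\Delta/S,1/S)$ exactly.) The action space is $\{0,1\}$ ($a=1$ means "ship"), and the loss is $L(\Delta,a)=-a\Delta$. A decision rule is a map $\delta:\mathbb{R}^n\to\{0,1\}$. Its risk is $R(\Delta,\delta)=\mathbb{E}[L(\Delta,\delta(X_1,\dots,X_n))\mid\Delta]$ and its Bayes risk is $r(\pi,\delta)=\mathbb{E}_{\Delta\sim\pi}[R(\Delta,\delta)]$. The rules considered are the thresholding rules $\delta_\beta$, $\beta\in\mathbb{R}$. *)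

theory Defs
  imports "HOL-Probability.Probability"
begin

text \<open>The second argument is the variance, whereas \<open>normal_density\<close> takes the standard deviation.\<close>

definition normal_law :: "real \<Rightarrow> real \<Rightarrow> real measure" where
  "normal_law m v = density lborel (\<lambda>x. ennreal (normal_density m (sqrt v) x))"

definition std_normal_cdf :: "real \<Rightarrow> real" ("\<Phi>") where
  "\<Phi> = cdf std_normal_distribution"

text \<open>The kernel \<open>K\<close> is a regular conditional distribution of \<open>X\<close> given \<open>\<Theta>\<close>: the measure
  \<open>K t\<close> is the law of \<open>X\<close> given \<open>\<Theta> = t\<close>. It is determined only up to null sets of the law
  of \<open>\<Theta>\<close>, so conditions on the conditional law are to be stated almost everywhere.\<close>

definition regular_cond_distr ::
  "'w measure \<Rightarrow> ('w \<Rightarrow> 'a::topological_space) \<Rightarrow> ('w \<Rightarrow> 'b::topological_space) \<Rightarrow> ('a \<Rightarrow> 'b measure) \<Rightarrow> bool" where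
  "regular_cond_distr M \<Theta> X K \<longleftrightarrow>
     K \<in> borel \<rightarrow>\<^sub>M prob_algebra borel \<and>
     (\<forall>A\<in>sets borel. \<forall>B\<in>sets borel.
        measure M {\<omega> \<in> space M. \<Theta> \<omega> \<in> A \<and> X \<omega> \<in> B} =
        (LINT t:A|distr M borel \<Theta>. measure (K t) B))"

text \<open>\<open>N\<close> is a law on \<open>\<real>\<^sup>n\<close> with independent coordinates, the \<open>j\<close>-th of mean \<open>d\<close> and
  standard deviation \<open>\<sigma> j\<close>.\<close>

definition noisy_measurements :: "('n::finite \<Rightarrow> real) \<Rightarrow> real \<Rightarrow> (real ^ 'n) measure \<Rightarrow> bool" where
  "noisy_measurements \<sigma> d N \<longleftrightarrow>
     prob_space.indep_vars N (\<lambda>_. borel) (\<lambda>j x. x $ j) UNIV \<and>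
     (\<forall>j. integrable N (\<lambda>x. x $ j) \<and> integrable N (\<lambda>x. (x $ j)\<^sup>2) \<and>
          prob_space.expectation N (\<lambda>x. x $ j) = d \<and>
          prob_space.variance N (\<lambda>x. x $ j) = (\<sigma> j)\<^sup>2)"

definition pooled_variance :: "('n::finite \<Rightarrow> real) \<Rightarrow> real" where
  "pooled_variance \<sigma> = inverse (\<Sum>j\<in>UNIV. 1 / (\<sigma> j)\<^sup>2)"

definition weighted_sum :: "('n::finite \<Rightarrow> real) \<Rightarrow> real ^ 'n \<Rightarrow> real" where
  "weighted_sum \<sigma> x = (\<Sum>j\<in>UNIV. x $ j / (\<sigma> j)\<^sup>2)"

text \<open>Actions are the natural numbers 0 and 1, where 1 means shipping the feature.\<close>

definition loss :: "real \<Rightarrow> nat \<Rightarrow> real" where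
  "loss d a = - (real a * d)"

definition threshold_rule :: "('n::finite \<Rightarrow> real) \<Rightarrow> real \<Rightarrow> real ^ 'n \<Rightarrow> nat" where
  "threshold_rule \<sigma> \<beta> x = (if weighted_sum \<sigma> x > \<beta> then 1 else 0)"

definition risk :: "(real \<Rightarrow> (real ^ 'n::finite) measure) \<Rightarrow> real \<Rightarrow> (real ^ 'n \<Rightarrow> nat) \<Rightarrow> real" where
  "risk K d \<delta> = (\<integral>x. loss d (\<delta> x) \<partial>K d)"

definition bayes_risk ::
  "real measure \<Rightarrow> (real \<Rightarrow> (real ^ 'n::finite) measure) \<Rightarrow> (real ^ 'n \<Rightarrow> nat) \<Rightarrow> real" where
  "bayes_risk \<pi> K \<delta> = (\<integral>d. risk K d \<delta> \<partial>\<pi>)"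

end

theory Submission
  imports Defs
begin

text \<open>
  Shipping exactly when \<open>Y > \<beta>\<close> gains \<open>E[\<Delta> 1{Y > \<beta>}]\<close>, and the Bayes risk is minus this gain.
  Conditioning on \<open>Y\<close> instead of \<open>\<Delta>\<close> turns the gain into an integral over \<open>y > \<beta>\<close> of the
  marginal density of \<open>Y\<close> times the posterior mean \<open>E[\<Delta> | Y = y]\<close>. By conjugacy of the normal
  prior the posterior is normal with mean \<open>(\<mu> + \<tau>\<^sup>2 y) / (1 + \<tau>\<^sup>2 / S)\<close>, which is an
  increasing function of \<open>y\<close> with its zero at \<open>- \<mu> / \<tau>\<^sup>2\<close>. Integrating over \<open>y > \<beta>\<close> collects
  all of the positive part of the integrand, and none of its negative part, exactly when \<open>\<beta>\<close>
  is this zero.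

  The change of conditioning is \<open>expectation_prior_times_tail\<close>, which combines the factorization
  \<open>normal_prior_times_likelihood\<close> with Fubini's theorem; the choice of the threshold is
  \<open>integral_above_sign_change_maximal\<close>. To reach these statements about densities from a
  random pair \<open>(\<Delta>, X)\<close>, \<open>regular_cond_distr_expectation\<close> extends the defining identity of a
  conditional distribution from events to expectations, and \<open>normal_law_upper_tail\<close> rewrites the
  conditional probability of shipping in terms of \<open>\<Phi>\<close>.
\<close>

section \<open>Normal laws and their tails\<close>

lemma prob_space_normal_law: "v > 0 \<Longrightarrow> prob_space (normal_law m v)"
  unfolding normal_law_def by (rule prob_space_normal_density) simp

lemma sets_normal_law [measurable_cong, simp]: "sets (normal_law m v) = sets borel"
  by (simp add: normal_law_def)

lemma integral_normal_law:
  fixes f :: "real \<Rightarrow> real"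
  assumes [measurable]: "f \<in> borel_measurable borel"
  shows "(\<integral>x. f x \<partial>normal_law m v) = (\<integral>x. normal_density m (sqrt v) x * f x \<partial>lborel)"
  unfolding normal_law_def by (subst integral_density) auto

lemma measure_normal_law:
  assumes "v > 0" and A: "A \<in> sets borel"
  shows "measure (normal_law m v) A = (\<integral>x. indicator A x * normal_density m (sqrt v) x \<partial>lborel)"
proof -
  interpret prob_space "normal_law m v"
    using assms(1) by (rule prob_space_normal_law)
  have "measure (normal_law m v) A = (\<integral>x. indicator A x \<partial>normal_law m v)"
    using A by simp
  also have "\<dots> = (\<integral>x. indicator A x * normal_density m (sqrt v) x \<partial>lborel)"
    using A by (subst integral_normal_law) (auto simp: mult.commute)
  finally show ?thesis .
qed

text \<open>
  The decreasing map \<open>x \<mapsto> m - sqrt v x\<close> sends a standard normal variable to one with law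
  \<open>normal_law m v\<close>. Using it rather than the increasing one takes upper tails to lower tails,
  which is how the symmetry of the normal distribution enters.
\<close>

lemma normal_law_upper_tail:
  assumes v: "v > 0"
  shows "measure (normal_law m v) {b<..} = \<Phi> ((m - b) / sqrt v)"
proof -
  interpret std: prob_space std_normal_distribution
    by (rule prob_space_normal_density) simp
  have "distributed std_normal_distribution lborel (\<lambda>x. x) std_normal_density"
    by (auto simp: distributed_def intro: distr_id2)
  from std.normal_density_affine[OF this, of "- sqrt v" m]
  have "distributed std_normal_distribution lborel (\<lambda>x. m - sqrt v * x) (normal_density m (sqrt v))"
    using v by simp
  then have law: "distr std_normal_distribution lborel (\<lambda>x. m - sqrt v * x) = normal_law m v"
    by (simp add: distributed_def normal_law_def)
  have "measure (normal_law m v) {b<..} =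
      measure std_normal_distribution {x. b < m - sqrt v * x}"
    unfolding law[symmetric] by (subst measure_distr) (auto intro!: arg_cong2[where f=measure])
  also have "{x. b < m - sqrt v * x} = {..<(m - b) / sqrt v}"
    using v by (auto simp: field_simps)
  \<comment> \<open>The distribution function is defined by closed half-lines; the end point is a null set.\<close>
  also have "measure std_normal_distribution \<dots> = measure std_normal_distribution {..(m - b) / sqrt v}"
  proof (rule measure_eq_AE)
    show "AE x in std_normal_distribution. (x \<in> {..<(m - b) / sqrt v}) = (x \<in> {..(m - b) / sqrt v})"
      using AE_lborel_singleton[of "(m - b) / sqrt v"] by (subst AE_density) (auto elim!: eventually_mono)
  qed simp_all
  finally show ?thesis
    by (simp add: std_normal_cdf_def cdf_def)
qed

section \<open>Conjugacy of the normal prior\<close>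

text \<open>
  The two expressions for the joint density of parameter and observation: prior times likelihood
  on the left, marginal times posterior on the right. The observation has mean \<open>\<kappa> d\<close> and variance
  \<open>\<kappa>\<close>, the form of an inverse-variance weighted sum with total precision \<open>\<kappa>\<close>. Completing the
  square in \<open>d\<close> gives posterior precision \<open>1 / \<tau>\<^sup>2 + \<kappa>\<close>.
\<close>

lemma normal_prior_times_likelihood:
  assumes "\<tau> > 0" "\<kappa> > 0"
  shows "normal_density \<mu> \<tau> d * normal_density (\<kappa> * d) (sqrt \<kappa>) y =
    normal_density (\<kappa> * \<mu>) (sqrt (\<kappa> * (1 + \<kappa> * \<tau>\<^sup>2))) y *
    normal_density ((\<mu> + \<tau>\<^sup>2 * y) / (1 + \<kappa> * \<tau>\<^sup>2)) (\<tau> / sqrt (1 + \<kappa> * \<tau>\<^sup>2)) d"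
proof -
  \<comment> \<open>The factor by which the observation increases the precision.\<close>
  define r where "r = 1 + \<kappa> * \<tau>\<^sup>2"
  have r: "r > 0"
    using assms by (simp add: r_def add_pos_nonneg)
  have "2 * pi * \<tau>\<^sup>2 * (2 * pi * \<kappa>) = 2 * pi * (\<kappa> * r) * (2 * pi * (\<tau>\<^sup>2 / r))"
    using r by (simp add: field_simps)
  then have norm: "sqrt (2 * pi * \<tau>\<^sup>2) * sqrt (2 * pi * \<kappa>) =
      sqrt (2 * pi * (\<kappa> * r)) * sqrt (2 * pi * (\<tau>\<^sup>2 / r))"
    by (metis real_sqrt_mult)
  have "r * (\<kappa> * (d - \<mu>)\<^sup>2 + \<tau>\<^sup>2 * (y - \<kappa> * d)\<^sup>2) =
      \<tau>\<^sup>2 * (y - \<kappa> * \<mu>)\<^sup>2 + \<kappa> * (r * d - (\<mu> + \<tau>\<^sup>2 * y))\<^sup>2"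
    unfolding r_def by algebra
  then have "(\<kappa> * (d - \<mu>)\<^sup>2 + \<tau>\<^sup>2 * (y - \<kappa> * d)\<^sup>2) / (2 * \<kappa> * \<tau>\<^sup>2) =
      (\<tau>\<^sup>2 * (y - \<kappa> * \<mu>)\<^sup>2 + \<kappa> * (r * d - (\<mu> + \<tau>\<^sup>2 * y))\<^sup>2) / (2 * \<kappa> * \<tau>\<^sup>2 * r)"
    using r assms by (simp add: divide_simps) algebra
  moreover have "r * d - (\<mu> + \<tau>\<^sup>2 * y) = r * (d - (\<mu> + \<tau>\<^sup>2 * y) / r)"
    using r by (simp add: field_simps)
  ultimately have exponent: "- (d - \<mu>)\<^sup>2 / (2 * \<tau>\<^sup>2) + - (y - \<kappa> * d)\<^sup>2 / (2 * \<kappa>) =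
      - (y - \<kappa> * \<mu>)\<^sup>2 / (2 * (\<kappa> * r)) + - (d - (\<mu> + \<tau>\<^sup>2 * y) / r)\<^sup>2 / (2 * (\<tau>\<^sup>2 / r))"
    using r assms by (simp add: power_mult_distrib) (simp add: field_simps power2_eq_square)
  have "normal_density \<mu> \<tau> d * normal_density (\<kappa> * d) (sqrt \<kappa>) y =
      exp (- (d - \<mu>)\<^sup>2 / (2 * \<tau>\<^sup>2) + - (y - \<kappa> * d)\<^sup>2 / (2 * \<kappa>)) /
      (sqrt (2 * pi * \<tau>\<^sup>2) * sqrt (2 * pi * \<kappa>))"
    using assms unfolding normal_density_def exp_add by simp
  also have "\<dots> = normal_density (\<kappa> * \<mu>) (sqrt (\<kappa> * r)) y *
      normal_density ((\<mu> + \<tau>\<^sup>2 * y) / r) (\<tau> / sqrt r) d"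
    using assms r unfolding norm exponent normal_density_def exp_add
    by (simp add: power_divide)
  finally show ?thesis
    unfolding r_def .
qed

text \<open>
  The left side is \<open>E[D 1{Y > \<beta>}]\<close> computed by conditioning on \<open>D\<close>, the right side is the same
  expectation computed by conditioning on \<open>Y\<close>; the last factor is the posterior mean of \<open>D\<close>.
\<close>

lemma expectation_prior_times_tail:
  assumes \<tau>: "\<tau> > 0" and \<kappa>: "\<kappa> > 0"
  shows "(\<integral>d. d * measure (normal_law (\<kappa> * d) \<kappa>) {\<beta><..} \<partial>normal_law \<mu> (\<tau>\<^sup>2)) =
    (\<integral>y. indicator {\<beta><..} y * (normal_density (\<kappa> * \<mu>) (sqrt (\<kappa> * (1 + \<kappa> * \<tau>\<^sup>2))) y *
      ((\<mu> + \<tau>\<^sup>2 * y) / (1 + \<kappa> * \<tau>\<^sup>2))) \<partial>lborel)"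
proof -
  define F where "F d y = normal_density \<mu> \<tau> d * d *
    (indicator {\<beta><..} y * normal_density (\<kappa> * d) (sqrt \<kappa>) y)" for d y :: real
  have likelihood_meas [measurable]:
    "(\<lambda>(d, y). normal_density (\<kappa> * d) (sqrt \<kappa>) y) \<in> borel_measurable (borel \<Otimes>\<^sub>M borel)"
    unfolding normal_density_def by measurable
  have tail: "(\<integral>y. indicator {\<beta><..} y * normal_density (\<kappa> * d) (sqrt \<kappa>) y \<partial>lborel) =
      measure (normal_law (\<kappa> * d) \<kappa>) {\<beta><..}" for d
    using \<kappa> by (simp add: measure_normal_law)
  have tail_meas [measurable]:
    "(\<lambda>d. measure (normal_law (\<kappa> * d) \<kappa>) {\<beta><..}) \<in> borel_measurable borel"
    unfolding tail[symmetric] by measurable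
  have F_section: "integrable lborel (F d)" for d
    using integrable_mult_indicator[of "{\<beta><..}" lborel "normal_density (\<kappa> * d) (sqrt \<kappa>)"] \<kappa>
    unfolding F_def by simp
  have prior_mean: "integrable lborel (\<lambda>d. normal_density \<mu> \<tau> d * d)"
    using \<tau> by (rule integrable_normal_moment_nz_1)
  \<comment> \<open>Integrating out \<open>y\<close> first leaves a probability, so the absolute first moment of the prior
    dominates.\<close>
  have "integrable (lborel \<Otimes>\<^sub>M lborel) (case_prod F)"
  proof (rule lborel_pair.Fubini_integrable)
    show "case_prod F \<in> borel_measurable (lborel \<Otimes>\<^sub>M lborel)"
      unfolding F_def by measurable
    have "(\<integral>y. norm (F d y) \<partial>lborel) =
        norm (normal_density \<mu> \<tau> d * d) * measure (normal_law (\<kappa> * d) \<kappa>) {\<beta><..}" for d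
      unfolding F_def norm_mult tail[symmetric] by (simp add: abs_mult)
    then have "integrable lborel (\<lambda>d. (\<integral>y. norm (F d y) \<partial>lborel))"
      using \<kappa> by (intro Bochner_Integration.integrable_bound[OF prior_mean])
        (auto simp: abs_mult mult_left_le prob_space.prob_le_1[OF prob_space_normal_law])
    then show "integrable lborel (\<lambda>d. \<integral>y. norm (case_prod F (d, y)) \<partial>lborel)"
      by simp
  qed (use F_section in simp)
  note Fubini = lborel_pair.Fubini_integral[OF this]
  have "(\<integral>d. d * measure (normal_law (\<kappa> * d) \<kappa>) {\<beta><..} \<partial>normal_law \<mu> (\<tau>\<^sup>2)) =
      (\<integral>d. (\<integral>y. F d y \<partial>lborel) \<partial>lborel)"
    using \<tau> by (simp add: integral_normal_law F_def tail mult.assoc)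
  also have "\<dots> = (\<integral>y. (\<integral>d. F d y \<partial>lborel) \<partial>lborel)"
    by (rule Fubini[symmetric])
  also have "\<dots> = (\<integral>y. indicator {\<beta><..} y *
      (normal_density (\<kappa> * \<mu>) (sqrt (\<kappa> * (1 + \<kappa> * \<tau>\<^sup>2))) y *
      ((\<mu> + \<tau>\<^sup>2 * y) / (1 + \<kappa> * \<tau>\<^sup>2))) \<partial>lborel)"
  proof (intro Bochner_Integration.integral_cong refl)
    fix y :: real
    let ?p = "normal_density (\<kappa> * \<mu>) (sqrt (\<kappa> * (1 + \<kappa> * \<tau>\<^sup>2))) y"
    have sd: "0 < \<tau> / sqrt (1 + \<kappa> * \<tau>\<^sup>2)"
      using \<tau> \<kappa> by (simp add: add_pos_nonneg)
    have "F d y = indicator {\<beta><..} y * ?p *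
        (normal_density ((\<mu> + \<tau>\<^sup>2 * y) / (1 + \<kappa> * \<tau>\<^sup>2)) (\<tau> / sqrt (1 + \<kappa> * \<tau>\<^sup>2)) d * d)" for d
      using normal_prior_times_likelihood[OF \<tau> \<kappa>, of \<mu> d y]
      by (simp add: F_def mult_ac)
    then show "(\<integral>d. F d y \<partial>lborel) = indicator {\<beta><..} y *
        (?p * ((\<mu> + \<tau>\<^sup>2 * y) / (1 + \<kappa> * \<tau>\<^sup>2)))"
      using integral_normal_moment_nz_1[OF sd] by simp
  qed
  finally show ?thesis .
qed

section \<open>The optimal threshold\<close>

text \<open>
  A function that is nonpositive up to \<open>c\<close> and nonnegative beyond has \<open>{c<..}\<close> as the best
  half-line, since \<open>indicator {c<..} y * h y\<close> is its positive part and hence a pointwise upper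
  bound for the integrand of every other half-line.
\<close>

lemma integral_above_sign_change_maximal:
  fixes h :: "real \<Rightarrow> real"
  assumes h: "integrable lborel h"
    and neg: "\<And>y. y \<le> c \<Longrightarrow> h y \<le> 0" and pos: "\<And>y. c < y \<Longrightarrow> 0 \<le> h y"
  shows "(\<integral>y. indicator {b<..} y * h y \<partial>lborel) \<le> (\<integral>y. indicator {c<..} y * h y \<partial>lborel)"
proof (rule integral_mono)
  show "integrable lborel (\<lambda>y. indicator {b<..} y * h y)"
    and "integrable lborel (\<lambda>y. indicator {c<..} y * h y)"
    using integrable_mult_indicator[OF _ h, of "{b<..}"] integrable_mult_indicator[OF _ h, of "{c<..}"]
    by simp_all
  show "indicator {b<..} y * h y \<le> indicator {c<..} y * h y" for y
    using neg[of y] pos[of y] by (auto simp: indicator_def)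
qed

text \<open>The marginal density is positive, so the sign change is that of the posterior mean.\<close>

lemma prior_times_tail_maximal:
  assumes \<tau>: "\<tau> > 0" and \<kappa>: "\<kappa> > 0"
  shows "(\<integral>d. d * measure (normal_law (\<kappa> * d) \<kappa>) {\<beta><..} \<partial>normal_law \<mu> (\<tau>\<^sup>2)) \<le>
    (\<integral>d. d * measure (normal_law (\<kappa> * d) \<kappa>) {- \<mu> / \<tau>\<^sup>2<..} \<partial>normal_law \<mu> (\<tau>\<^sup>2))"
  unfolding expectation_prior_times_tail[OF assms]
proof (rule integral_above_sign_change_maximal)
  let ?m = "\<lambda>y. (\<mu> + \<tau>\<^sup>2 * y) / (1 + \<kappa> * \<tau>\<^sup>2)"
  let ?s = "sqrt (\<kappa> * (1 + \<kappa> * \<tau>\<^sup>2))"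
  have s: "0 < ?s" and r: "0 < 1 + \<kappa> * \<tau>\<^sup>2"
    using \<kappa> by (simp_all add: add_pos_nonneg)
  have "integrable lborel (\<lambda>y. \<mu> / (1 + \<kappa> * \<tau>\<^sup>2) * normal_density (\<kappa> * \<mu>) ?s y +
      \<tau>\<^sup>2 / (1 + \<kappa> * \<tau>\<^sup>2) * (normal_density (\<kappa> * \<mu>) ?s y * y))"
    using integrable_normal_density[OF s] integrable_normal_moment_nz_1[OF s]
    by (intro Bochner_Integration.integrable_add integrable_mult_right)
  then show "integrable lborel (\<lambda>y. normal_density (\<kappa> * \<mu>) ?s y * ?m y)"
    by (simp add: add_divide_distrib algebra_simps)
  show "normal_density (\<kappa> * \<mu>) ?s y * ?m y \<le> 0" if "y \<le> - \<mu> / \<tau>\<^sup>2" for y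
    using that \<tau> r by (intro mult_nonneg_nonpos divide_nonpos_pos) (auto simp: field_simps)
  show "0 \<le> normal_density (\<kappa> * \<mu>) ?s y * ?m y" if "- \<mu> / \<tau>\<^sup>2 < y" for y
    using that \<tau> r by (intro mult_nonneg_nonneg divide_nonneg_pos) (auto simp: field_simps)
qed

section \<open>Risk of threshold rules\<close>

text \<open>
  The definition of \<open>regular_cond_distr\<close> fixes the probabilities of rectangles \<open>A \<times> B\<close>. For
  fixed \<open>B\<close> it says that two measures agree on every \<open>A\<close>: the law of \<open>\<Theta>\<close> on the event
  \<open>X \<in> B\<close>, and the law of \<open>\<Theta>\<close> weighted by \<open>K t B\<close>. The claim is the equality of the integrals
  of \<open>g\<close> against these two measures.
\<close>

lemma regular_cond_distr_expectation:
  fixes g :: "'a::topological_space \<Rightarrow> real" and X :: "'w \<Rightarrow> 'b::topological_space"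
  assumes "prob_space M"
    and \<Theta> [measurable]: "\<Theta> \<in> M \<rightarrow>\<^sub>M borel" and X [measurable]: "X \<in> M \<rightarrow>\<^sub>M borel"
    and K: "regular_cond_distr M \<Theta> X K"
    and g [measurable]: "g \<in> borel_measurable borel" and B [measurable]: "B \<in> sets borel"
  shows "(\<integral>\<omega>. g (\<Theta> \<omega>) * indicator B (X \<omega>) \<partial>M) =
    (\<integral>t. g t * measure (K t) B \<partial>distr M borel \<Theta>)"
proof -
  interpret prob_space M by fact
  interpret \<Theta>: prob_space "distr M borel \<Theta>" by (rule prob_space_distr) simp
  have K_meas [measurable]: "K \<in> borel \<rightarrow>\<^sub>M prob_algebra borel"
    using K by (simp add: regular_cond_distr_def)
  have K_prob: "prob_space (K t)" for t
    using measurable_space[OF K_meas, of t] by (simp add: space_prob_algebra)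
  have [measurable]: "(\<lambda>t. measure (K t) B) \<in> borel_measurable borel"
    using measurable_measure_subprob_algebra[OF B] measurable_prob_algebraD[OF K_meas]
    by (rule measurable_compose[rotated])
  have "distr (density M (\<lambda>\<omega>. ennreal (indicator B (X \<omega>)))) borel \<Theta> =
      density (distr M borel \<Theta>) (\<lambda>t. ennreal (measure (K t) B))" (is "?L = ?R")
  proof (rule measure_eqI)
    fix A assume "A \<in> sets ?L"
    then have A [measurable]: "A \<in> sets borel" by simp
    have "emeasure ?L A = (\<integral>\<^sup>+\<omega>. indicator {\<omega> \<in> space M. \<Theta> \<omega> \<in> A \<and> X \<omega> \<in> B} \<omega> \<partial>M)"
      by (simp add: emeasure_distr emeasure_density del: nn_integral_indicator)
        (auto intro!: nn_integral_cong simp: indicator_def)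
    also have "\<dots> = ennreal (measure M {\<omega> \<in> space M. \<Theta> \<omega> \<in> A \<and> X \<omega> \<in> B})"
      by (subst nn_integral_indicator) (simp_all add: emeasure_eq_measure)
    also have "\<dots> = ennreal (\<integral>t. indicator A t * measure (K t) B \<partial>distr M borel \<Theta>)"
      using K A B by (simp add: regular_cond_distr_def set_lebesgue_integral_def)
    also have "\<dots> = (\<integral>\<^sup>+t. ennreal (indicator A t * measure (K t) B) \<partial>distr M borel \<Theta>)"
      by (intro nn_integral_eq_integral[symmetric] \<Theta>.integrable_const_bound[where B=1])
        (auto simp: indicator_def prob_space.prob_le_1[OF K_prob])
    also have "\<dots> = emeasure ?R A"
      by (subst emeasure_density) (auto intro!: nn_integral_cong simp: indicator_def)
    finally show "emeasure ?L A = emeasure ?R A" .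
  qed simp
  then have "integral\<^sup>L ?L g = integral\<^sup>L ?R g" by simp
  then show ?thesis
    by (simp add: integral_distr integral_density mult.commute)
qed

lemma risk_threshold_rule:
  fixes \<sigma> :: "'n::finite \<Rightarrow> real"
  shows "risk K d (threshold_rule \<sigma> \<beta>) = - d * measure (K d) {x \<in> space (K d). \<beta> < weighted_sum \<sigma> x}"
proof -
  have "loss d (threshold_rule \<sigma> \<beta> x) = - d * indicator {x. \<beta> < weighted_sum \<sigma> x} x" for x
    by (simp add: loss_def threshold_rule_def)
  then show ?thesis
    by (simp add: risk_def Int_def conj_commute)
qed

lemma pooled_variance_pos:
  fixes \<sigma> :: "'n::finite \<Rightarrow> real"
  assumes "\<And>j. \<sigma> j > 0"
  shows "pooled_variance \<sigma> > 0"
proof -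
  have "0 < 1 / (\<sigma> j)\<^sup>2" for j
    using assms[of j] by simp
  then show ?thesis
    unfolding pooled_variance_def by (intro positive_imp_inverse_positive sum_pos) auto
qed

lemma borel_measurable_weighted_sum [measurable]: "weighted_sum \<sigma> \<in> borel_measurable borel"
  unfolding weighted_sum_def by measurable

theorem theorem3:
  fixes M :: "'w measure"
    and \<Delta> :: "'w \<Rightarrow> real"
    and X :: "'w \<Rightarrow> real ^ 'n::finite"
    and K :: "real \<Rightarrow> (real ^ 'n) measure"
    and \<sigma> :: "'n \<Rightarrow> real"
    and \<mu> \<tau> S :: real
    and \<pi> :: "real measure"
    and Y :: "'w \<Rightarrow> real"
  assumes "prob_space M"
    and sigma_pos: "\<And>j. \<sigma> j > 0"
    and tau_pos: "\<tau> > 0"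
    and S_def: "S = pooled_variance \<sigma>"
    and prior_def: "\<pi> = normal_law \<mu> (\<tau>\<^sup>2)"
    and Delta_meas: "\<Delta> \<in> borel_measurable M"
    and Delta_prior: "distr M borel \<Delta> = \<pi>"
    and X_meas: "X \<in> borel_measurable M"
    and X_given_Delta: "regular_cond_distr M \<Delta> X K"
    and X_noise: "AE d in \<pi>. noisy_measurements \<sigma> d (K d)"
    and Y_def: "\<And>\<omega>. Y \<omega> = weighted_sum \<sigma> (X \<omega>)"
    and Y_given_Delta: "AE d in \<pi>. distr (K d) borel (weighted_sum \<sigma>) = normal_law (d / S) (1 / S)"
  shows "(\<forall>\<beta>. bayes_risk \<pi> K (threshold_rule \<sigma> \<beta>) =
               (\<integral>\<omega>. - \<Delta> \<omega> * indicator {\<omega>. Y \<omega> > \<beta>} \<omega> \<partial>M) \<and>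
             (\<integral>\<omega>. - \<Delta> \<omega> * indicator {\<omega>. Y \<omega> > \<beta>} \<omega> \<partial>M) =
               (\<integral>d. - d * \<Phi> ((d / S - \<beta>) / (1 / sqrt S)) \<partial>\<pi>)) \<and>
         (\<forall>\<beta>. bayes_risk \<pi> K (threshold_rule \<sigma> (- \<mu> / \<tau>\<^sup>2)) \<le> bayes_risk \<pi> K (threshold_rule \<sigma> \<beta>))"
proof -
  interpret prob_space M by fact
  have S: "S > 0"
    using sigma_pos pooled_variance_pos S_def by blast
  let ?B = "\<lambda>\<beta>. {x. \<beta> < weighted_sum \<sigma> x}"
  have K_meas: "K \<in> borel \<rightarrow>\<^sub>M prob_algebra borel"
    using X_given_Delta by (simp add: regular_cond_distr_def)
  have K_sets: "sets (K d) = sets borel" for d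
    using measurable_space[OF K_meas, of d] by (simp add: space_prob_algebra)
  have K_space: "space (K d) = UNIV" for d
    using sets_eq_imp_space_eq[OF K_sets, of d] by simp
  have B_sets [measurable]: "?B \<beta> \<in> sets borel" for \<beta>
    by measurable
  have prob_B_meas [measurable]: "(\<lambda>d. measure (K d) (?B \<beta>)) \<in> borel_measurable borel" for \<beta>
    using measurable_measure_subprob_algebra[OF B_sets] measurable_prob_algebraD[OF K_meas]
    by (rule measurable_compose[rotated])
  have bayes: "bayes_risk \<pi> K (threshold_rule \<sigma> \<beta>) = (\<integral>d. - d * measure (K d) (?B \<beta>) \<partial>\<pi>)" for \<beta>
    by (simp add: bayes_risk_def risk_threshold_rule K_space)
  have joint: "(\<integral>\<omega>. - \<Delta> \<omega> * indicator {\<omega>. Y \<omega> > \<beta>} \<omega> \<partial>M) =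
      (\<integral>d. - d * measure (K d) (?B \<beta>) \<partial>\<pi>)" for \<beta>
    using regular_cond_distr_expectation[OF \<open>prob_space M\<close> Delta_meas X_meas X_given_Delta,
        of uminus "?B \<beta>"]
    by (simp add: Delta_prior Y_def indicator_def)
  \<comment> \<open>With \<open>\<kappa> = 1 / S\<close>, the conditional law of \<open>Y\<close> has the form \<open>N(\<kappa> d, \<kappa>)\<close> treated above.\<close>
  have Y_law: "AE d in \<pi>. measure (K d) (?B \<beta>) = measure (normal_law (1 / S * d) (1 / S)) {\<beta><..}" for \<beta>
    using Y_given_Delta
  proof eventually_elim
    case (elim d)
    have "measure (distr (K d) borel (weighted_sum \<sigma>)) {\<beta><..} = measure (K d) (?B \<beta>)"
      by (subst measure_distr)
        (auto simp: K_space measurable_cong_sets[OF K_sets refl] intro!: arg_cong2[where f=measure])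
    then show ?case
      by (simp add: elim)
  qed
  have tail: "measure (normal_law (1 / S * d) (1 / S)) {\<beta><..} = \<Phi> ((d / S - \<beta>) / (1 / sqrt S))"
    for d \<beta>
    using S by (simp add: normal_law_upper_tail real_sqrt_divide)
  have Phi_meas [measurable]: "\<Phi> \<in> borel_measurable borel"
    unfolding std_normal_cdf_def
    by (rule borel_measurable_mono) (auto intro!: monoI finite_borel_measure.cdf_nondecreasing
      real_distribution.finite_borel_measure_M real_dist_normal_dist)
  have normal: "(\<integral>d. - d * measure (K d) (?B \<beta>) \<partial>\<pi>) =
      (\<integral>d. - d * measure (normal_law (1 / S * d) (1 / S)) {\<beta><..} \<partial>\<pi>)" for \<beta>
    using Y_law[of \<beta>] unfolding tail by (intro integral_cong_AE) (auto simp: prior_def)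
  have "bayes_risk \<pi> K (threshold_rule \<sigma> (- \<mu> / \<tau>\<^sup>2)) \<le> bayes_risk \<pi> K (threshold_rule \<sigma> \<beta>)" for \<beta>
    using prior_times_tail_maximal[OF tau_pos, of "1 / S" \<mu> \<beta>] S
    unfolding bayes normal by (simp add: prior_def)
  then show ?thesis
    by (simp only: bayes joint normal tail) simp
qed

end
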